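(* Let $T\in G$ be an elliptic isometry. Then: (1) $T$ is unitary up to conjugacy, i.e. there is $R\in G$ such that $R^{-1}TR$ is a unitary operator on the Hilbert space $H\oplus\mathbb{C}$. (2) $\sigma(T)\subseteq S^1$. (3) $T$ has a time-like eigenvector; and conversely, any isometry in $G$ having a time-like eigenvector is elliptic. (4) If $(x,1)$ is a time-like eigenvector of $T$, then $H\oplus\mathbb{C}=\langle (x,1)\rangle\oplus\langle (x,1)\rangle^{\dagger}$ and $T=T_1\oplus T_2$, where $T_1=T|_{\langle (x,1)\rangle}$ and $T_2=T|_{\langle (x,1)\rangle^{\dagger}}$. Moreover $T_2\in\mathcal{U}(\langle (x,1)\rangle^{\dagger})$.
   Context: $H$ is a complex Hilbert space with inner product $\langle\cdot,\cdot\rangle$ (linear in the first variable), $B$ its open unit ball. $H\oplus\mathbb{C}$ is the Hilbert space direct sum. $\mathcal{A}((x,z),(y,w))=\langle x,y\rangle-z\overline{w}$ is a Hermitian form on $H\oplus\mathbb{C}$, and $\mathcal{Q}(v)=\mathcal{A}(v,v)$. $G$ is the group of all bijective bounded linear operators on $H\oplus\mathbb{C}$ preserving $\mathcal{A}$; its elements are called isometries. Each $T\in G$ acts on $\overline{B}$ by $\widetilde{T}(x)=y/w$ where $T(x,1)=(y,w)$ (one has $w\neq 0$); these maps restricted to $B$ are exactly the biholomorphic automorphisms of $B$. $T$ is elliptic if $\widetilde{T}$ has a fixed point in $B$. A vector $v$ is time-like if $\mathcal{Q}(v)<0$. $\langle v\rangle$ is the complex line spanned by $v$. For a subspace $M$,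 $M^{\dagger}=\{v:\mathcal{A}(v,m)=0\ \forall m\in M\}$. When $\mathcal{A}|_{M^\dagger}$ is positive definite and complete, $M^\dagger$ is regarded as a Hilbert space with inner product $\mathcal{A}|_{M^{\dagger}}$ and $\mathcal{U}(M^{\dagger})$ is its unitary group (that this applies is part of the assertion). $S^1$ is the unit circle in $\mathbb{C}$ and $\sigma(T)$ the spectrum of $T$. *)

theory Defs
  imports "HOL-Analysis.Analysis"
begin

section \<open>Complex Hilbert spaces\<close>

text \<open>The library has real inner product spaces only.  A complex Hilbert space is a complete real
  inner product space with a compatible complex scalar multiplication and a complex inner product,
  linear in the first argument, whose real part is the given real inner product.  The norm is then
  \<open>norm x = sqrt (Re (cinner x x))\<close>, and positive definiteness is inherited from
  \<open>real_inner\<close>.\<close>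

class chilbert_space = real_inner + complete_space +
  fixes scaleC :: "complex \<Rightarrow> 'a \<Rightarrow> 'a"  (infixr "*\<^sub>C" 75)
    and cinner :: "'a \<Rightarrow> 'a \<Rightarrow> complex"
  assumes scaleC_add_right: "a *\<^sub>C (x + y) = a *\<^sub>C x + a *\<^sub>C y"
    and scaleC_add_left: "(a + b) *\<^sub>C x = a *\<^sub>C x + b *\<^sub>C x"
    and scaleC_scaleC: "a *\<^sub>C b *\<^sub>C x = (a * b) *\<^sub>C x"
    and scaleR_scaleC: "r *\<^sub>R x = complex_of_real r *\<^sub>C x"
    and cinner_add_left: "cinner (x + y) z = cinner x z + cinner y z"
    and cinner_scaleC_left: "cinner (a *\<^sub>C x) y = a * cinner x y"
    and cinner_commute: "cinner x y = cnj (cinner y x)"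
    and inner_eq_Re_cinner: "inner x y = Re (cinner x y)"

lemma scaleC_one: "1 *\<^sub>C x = (x :: 'a::chilbert_space)"
  using scaleR_scaleC[of 1 x] by simp

global_interpretation complex_vector:
    vector_space "scaleC :: complex \<Rightarrow> 'a \<Rightarrow> 'a::chilbert_space"
  defines csubspace = complex_vector.subspace
    and cspan = complex_vector.span
  by unfold_locales (auto simp: scaleC_add_right scaleC_add_left scaleC_scaleC scaleC_one)

instantiation complex :: chilbert_space
begin

definition scaleC_complex_def: "scaleC a (x :: complex) = a * x"
definition cinner_complex_def: "cinner x (y :: complex) = x * cnj y"

instance
  by standard
    (auto simp: scaleC_complex_def cinner_complex_def algebra_simps scaleR_conv_of_real
      inner_complex_def)

end

text \<open>The Hilbert space direct sum; the library already provides its real inner product, norm and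
  completeness.\<close>

instantiation prod :: (chilbert_space, chilbert_space) chilbert_space
begin

definition scaleC_prod_def: "scaleC a (p :: 'a \<times> 'b) = (a *\<^sub>C fst p, a *\<^sub>C snd p)"
definition cinner_prod_def:
  "cinner p (q :: 'a \<times> 'b) = cinner (fst p) (fst q) + cinner (snd p) (snd q)"

instance
proof
  fix x y :: "'a \<times> 'b"
  show "cinner x y = cnj (cinner y x)"
    unfolding cinner_prod_def using cinner_commute[of "fst x"] cinner_commute[of "snd x"] by simp
qed (auto simp: scaleC_prod_def cinner_prod_def scaleC_add_right scaleC_add_left scaleC_scaleC
      cinner_add_left cinner_scaleC_left inner_prod_def inner_eq_Re_cinner algebra_simps
      scaleR_scaleC prod_eq_iff)

end


section \<open>Operators\<close>

definition bounded_clinear :: "('a::chilbert_space \<Rightarrow> 'b::chilbert_space) \<Rightarrow> bool" where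
  "bounded_clinear T \<longleftrightarrow> bounded_linear T \<and> (\<forall>c v. T (c *\<^sub>C v) = c *\<^sub>C T v)"

definition eigenvector :: "('a::chilbert_space \<Rightarrow> 'a) \<Rightarrow> 'a \<Rightarrow> bool" where
  "eigenvector T v \<longleftrightarrow> v \<noteq> 0 \<and> (\<exists>c. T v = c *\<^sub>C v)"

definition op_spectrum :: "('a::chilbert_space \<Rightarrow> 'a) \<Rightarrow> complex set" where
  "op_spectrum T = {c. \<not> (\<exists>S. bounded_clinear S \<and>
      (\<forall>v. S (T v - c *\<^sub>C v) = v) \<and> (\<forall>v. T (S v) - c *\<^sub>C S v = v))}"

text \<open>\<open>M\<close> is a complex Hilbert space for the restriction of the form \<open>f\<close>; completeness
  refers to the norm \<open>sqrt (f v v)\<close> and not to the ambient norm.\<close>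

definition hilbert_on :: "'a::chilbert_space set \<Rightarrow> ('a \<Rightarrow> 'a \<Rightarrow> complex) \<Rightarrow> bool" where
  "hilbert_on M f \<longleftrightarrow> csubspace M \<and>
     (\<forall>u\<in>M. \<forall>v\<in>M. \<forall>w\<in>M. f (u + v) w = f u w + f v w) \<and>
     (\<forall>c. \<forall>u\<in>M. \<forall>v\<in>M. f (c *\<^sub>C u) v = c * f u v) \<and>
     (\<forall>u\<in>M. \<forall>v\<in>M. f u v = cnj (f v u)) \<and>
     (\<forall>u\<in>M. u \<noteq> 0 \<longrightarrow> Re (f u u) > 0) \<and>
     (\<forall>s :: nat \<Rightarrow> 'a. range s \<subseteq> M \<longrightarrow>
        (\<forall>e>0. \<exists>N. \<forall>m\<ge>N. \<forall>n\<ge>N. sqrt (Re (f (s m - s n) (s m - s n))) < e) \<longrightarrow>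
        (\<exists>l\<in>M. (\<lambda>n. sqrt (Re (f (s n - l) (s n - l)))) \<longlonglongrightarrow> 0))"

text \<open>The unitary group of \<open>M\<close> with inner product \<open>f\<close>.  Its elements are operators on \<open>M\<close>,
  encoded as functions that are \<open>undefined\<close> outside \<open>M\<close>.  Boundedness follows from
  preservation of \<open>f\<close>.\<close>

definition unitary_group :: "'a::chilbert_space set \<Rightarrow> ('a \<Rightarrow> 'a \<Rightarrow> complex) \<Rightarrow> ('a \<Rightarrow> 'a) set" where
  "unitary_group M f = {U \<in> extensional M. bij_betw U M M \<and>
     (\<forall>u\<in>M. \<forall>v\<in>M. U (u + v) = U u + U v) \<and>
     (\<forall>c. \<forall>u\<in>M. U (c *\<^sub>C u) = c *\<^sub>C U u) \<and>
     (\<forall>u\<in>M. \<forall>v\<in>M. f (U u) (U v) = f u v)}"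

lemma hilbert_on_UNIV_cinner: "hilbert_on (UNIV :: 'a::chilbert_space set) cinner"
proof -
  have n: "sqrt (Re (cinner x x)) = norm x" for x :: 'a
    by (simp add: norm_eq_sqrt_inner inner_eq_Re_cinner)
  have "\<exists>l. (\<lambda>k. norm (s k - l)) \<longlonglongrightarrow> 0"
    if "\<forall>e>0. \<exists>N. \<forall>m\<ge>N. \<forall>k\<ge>N. norm (s m - s k) < e" for s :: "nat \<Rightarrow> 'a"
  proof -
    have "Cauchy s"
      using that by (simp add: Cauchy_def dist_norm)
    then obtain l where "s \<longlonglongrightarrow> l"
      using Cauchy_convergent_iff convergent_def by blast
    then show ?thesis
      using tendsto_norm_zero LIM_zero by blast
  qed
  moreover have "0 < Re (cinner x x)" if "x \<noteq> 0" for x :: 'a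
    using that by (metis inner_eq_Re_cinner inner_gt_zero_iff)
  ultimately show ?thesis
    unfolding hilbert_on_def n
    by (auto simp: cinner_add_left cinner_scaleC_left intro: cinner_commute)
qed

definition direct_sum_of :: "'a::chilbert_space set \<Rightarrow> 'a set \<Rightarrow> bool" where
  "direct_sum_of M N \<longleftrightarrow> csubspace M \<and> closed M \<and> csubspace N \<and> closed N \<and>
     M \<inter> N = {0} \<and> (\<forall>v. \<exists>m\<in>M. \<exists>n\<in>N. v = m + n)"

text \<open>\<open>T\<close> is the direct sum of an operator \<open>T1\<close> on \<open>M\<close> and an operator \<open>T2\<close> on \<open>N\<close>.\<close>

definition op_direct_sum ::
  "('a::chilbert_space \<Rightarrow> 'a) \<Rightarrow> 'a set \<Rightarrow> ('a \<Rightarrow> 'a) \<Rightarrow> 'a set \<Rightarrow> ('a \<Rightarrow> 'a) \<Rightarrow> bool" where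
  "op_direct_sum T M T1 N T2 \<longleftrightarrow> T1 ` M \<subseteq> M \<and> T2 ` N \<subseteq> N \<and>
     (\<forall>m\<in>M. \<forall>n\<in>N. T (m + n) = T1 m + T2 n)"


section \<open>The indefinite form on the direct sum with the complex line\<close>

definition formA :: "'a::chilbert_space \<times> complex \<Rightarrow> 'a \<times> complex \<Rightarrow> complex" where
  "formA u v = cinner (fst u) (fst v) - snd u * cnj (snd v)"

text \<open>The real part only changes the type, as \<open>formA v v\<close> is real (\<open>formA_self\<close>).\<close>

definition formQ :: "'a::chilbert_space \<times> complex \<Rightarrow> real" where
  "formQ v = Re (formA v v)"

lemma formA_commute: "formA u v = cnj (formA v u)"
  unfolding formA_def using cinner_commute[of "fst u" "fst v"] by simp

lemma formA_self: "formA v v = complex_of_real (formQ v)"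
  using arg_cong[OF formA_commute[of v v], of Im] by (simp add: formQ_def complex_eq_iff)

lemma formQ_eq: "formQ (x, z) = (norm x)\<^sup>2 - (norm z)\<^sup>2"
  unfolding formQ_def formA_def
  by (simp add: power2_norm_eq_inner inner_eq_Re_cinner[where 'a = 'a] flip: complex_norm_square)

definition time_like :: "'a::chilbert_space \<times> complex \<Rightarrow> bool" where
  "time_like v \<longleftrightarrow> formQ v < 0"

definition dagger :: "('a::chilbert_space \<times> complex) set \<Rightarrow> ('a \<times> complex) set" where
  "dagger M = {v. \<forall>m\<in>M. formA v m = 0}"

definition isometry_group :: "('a::chilbert_space \<times> complex \<Rightarrow> 'a \<times> complex) set" where
  "isometry_group = {T. bounded_clinear T \<and> bij T \<and> (\<forall>u v. formA (T u) (T v) = formA u v)}"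

definition ball_action :: "('a::chilbert_space \<times> complex \<Rightarrow> 'a \<times> complex) \<Rightarrow> 'a \<Rightarrow> 'a" where
  "ball_action T x = (let (y, w) = T (x, 1) in inverse w *\<^sub>C y)"

text \<open>The convention \<open>inverse 0 = 0\<close> plays no role in \<open>ball_action\<close>:\<close>

lemma ball_action_denominator_nonzero:
  assumes T: "T \<in> isometry_group" and x: "x \<in> cball 0 1"
  shows "snd (T (x, 1)) \<noteq> 0"
proof
  assume w: "snd (T (x, 1)) = 0"
  have lin: "bounded_linear T" and "inj T"
    using T by (auto simp: isometry_group_def bounded_clinear_def bij_def)
  have "formQ (T (x, 1)) = formQ (x, 1)"
    using T by (simp add: isometry_group_def formQ_def)
  also have "\<dots> \<le> 0"
    using x by (simp add: formQ_eq power_le_one)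
  finally have "(norm (fst (T (x, 1))))\<^sup>2 \<le> 0"
    using w by (cases "T (x, 1)") (simp add: formQ_eq)
  then have "T (x, 1) = T 0"
    using w linear_0[OF bounded_linear.linear[OF lin]] by (simp add: prod_eq_iff)
  then have "(x, 1 :: complex) = 0"
    using \<open>inj T\<close> by (simp only: inj_eq)
  then show False
    by (simp add: zero_prod_def)
qed

definition elliptic :: "('a::chilbert_space \<times> complex \<Rightarrow> 'a \<times> complex) \<Rightarrow> bool" where
  "elliptic T \<longleftrightarrow> (\<exists>x\<in>ball 0 1. ball_action T x = x)"

end

theory Submission
  imports Defs
begin

text \<open>If \<open>T\<close> has the time-like eigenvector \<open>(x, 1)\<close>, let \<open>R\<close> be the half-turn about the
  sum of \<open>(0, 1)\<close> and the normalisation of \<open>(x, 1)\<close>.  It is an involution in the group that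
  exchanges these two lines.  Hence \<open>R \<circ> T \<circ> R\<close> preserves the form and fixes the line of
  \<open>(0, 1)\<close>, so it is unitary, and its spectrum is that of \<open>T\<close>.
  For a unitary \<open>U\<close> and \<open>c\<close> off the unit circle, \<open>U v - c v = y\<close> is the fixed point equation
  of a contraction, either \<open>v \<mapsto> U\<^sup>-\<^sup>1 (y + c v)\<close> or \<open>v \<mapsto> (U v - y) / c\<close>.  Moreover \<open>R\<close> maps the
  complement of \<open>(x, 1)\<close> isometrically onto \<open>H \<times> {0}\<close>, where the form is the inner product;
  this gives definiteness and completeness.\<close>

section \<open>Continuity of the complex inner product and scalar multiplication\<close>

lemma cinner_zero_left: "cinner 0 x = 0"
  using cinner_add_left[of 0 0 x] by simp

lemma cinner_zero_right: "cinner x 0 = 0"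
  using cinner_commute[of x 0] by (simp add: cinner_zero_left)

lemma cinner_scaleC_right: "cinner x (a *\<^sub>C y) = cnj a * cinner x y"
  using cinner_commute[of x "a *\<^sub>C y"] cinner_commute[of x y] by (simp add: cinner_scaleC_left)

lemma norm_scaleC: "norm (a *\<^sub>C x) = norm a * norm x"
proof -
  have "cinner (a *\<^sub>C x) (a *\<^sub>C x) = of_real ((norm a)\<^sup>2) * cinner x x"
    by (simp add: cinner_scaleC_left cinner_scaleC_right complex_norm_square mult_ac
        del: of_real_power)
  then have "inner (a *\<^sub>C x) (a *\<^sub>C x) = (norm a)\<^sup>2 * inner x x"
    by (simp add: inner_eq_Re_cinner)
  then show ?thesis
    by (simp add: norm_eq_sqrt_inner real_sqrt_mult)
qed

lemma bounded_bilinear_scaleC: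
  "bounded_bilinear (scaleC :: complex \<Rightarrow> 'a \<Rightarrow> 'a::chilbert_space)"
proof
  show "\<exists>K. \<forall>a (b :: 'a). norm (a *\<^sub>C b) \<le> norm a * norm b * K"
    by (intro exI[of _ 1]) (simp add: norm_scaleC)
qed (simp_all add: scaleC_add_left scaleC_add_right scaleR_scaleC scaleC_scaleC
       scaleC_complex_def mult.commute)

text \<open>The real and imaginary parts of \<open>cinner v u\<close> are the real inner products of
  \<open>v\<close> with \<open>u\<close> and with \<open>\<i> *\<^sub>C u\<close>, both bounded
  linear in \<open>v\<close>.\<close>

lemma bounded_linear_cinner_left: "bounded_linear (\<lambda>v. cinner v u)"
proof -
  have "cinner v u = of_real (inner v u) + of_real (inner v (\<i> *\<^sub>C u)) * \<i>" for v
    by (simp add: inner_eq_Re_cinner cinner_scaleC_right complex_eq_iff)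
  then show ?thesis
    by (simp only:) (intro bounded_linear_add bounded_linear_compose[OF bounded_linear_of_real]
        bounded_linear_compose[OF bounded_linear_mult_left] bounded_linear_inner_left)
qed

section \<open>Sesquilinearity and continuity of the indefinite form\<close>

lemma formA_add_left: "formA (u + v) w = formA u w + formA v w"
  by (simp add: formA_def cinner_add_left algebra_simps)

lemma formA_scaleC_left: "formA (c *\<^sub>C u) v = c * formA u v"
  by (simp add: formA_def scaleC_prod_def cinner_scaleC_left scaleC_complex_def algebra_simps)

lemma formA_diff_left: "formA (u - v) w = formA u w - formA v w"
  using formA_add_left[of "u - v" v w] by simp

lemma formA_scaleC_right: "formA u (c *\<^sub>C v) = cnj c * formA u v"
  by (simp add: formA_def scaleC_prod_def cinner_scaleC_right scaleC_complex_def algebra_simps)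

lemma formA_diff_right: "formA u (v - w) = formA u v - formA u w"
  using formA_diff_left[of v w u] formA_commute[of u] by (metis complex_cnj_diff)

lemma bounded_linear_formA_left: "bounded_linear (\<lambda>v. formA v u)"
  unfolding formA_def
  by (intro bounded_linear_sub bounded_linear_compose[OF bounded_linear_cinner_left]
      bounded_linear_compose[OF bounded_linear_mult_left] bounded_linear_fst bounded_linear_snd)

lemma time_like_iff: "time_like (x, w) \<longleftrightarrow> norm x < norm w"
  using abs_le_square_iff[of "norm w" "norm x"]
  by (simp add: time_like_def formQ_eq flip: linorder_not_le)

lemma isometry_groupD:
  assumes "T \<in> isometry_group"
  shows "bounded_linear T" "T (c *\<^sub>C v) = c *\<^sub>C T v" "T (u + v) = T u + T v"
    "bij T" "formA (T u) (T v) = formA u v"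
  using assms linear_add[OF bounded_linear.linear, of T]
  by (auto simp: isometry_group_def bounded_clinear_def simp del: split_paired_All)

section \<open>Half-turns about non-isotropic lines\<close>

text \<open>Twice the form-orthogonal projection onto the line of \<open>u\<close>, minus the
  identity: for non-isotropic \<open>u\<close> it is 1 on that line and -1 on its
  complement.\<close>

definition half_turn :: "'a::chilbert_space \<times> complex \<Rightarrow> 'a \<times> complex \<Rightarrow> 'a \<times> complex" where
  "half_turn u v = (2 * formA v u / formA u u) *\<^sub>C u - v"

text \<open>The half-turn leaves \<open>formA v u\<close> unchanged, so the second application
  subtracts its argument from the same multiple of \<open>u\<close> as the first.\<close>

lemma half_turn_half_turn:
  assumes "formA u u \<noteq> 0"
  shows "half_turn u (half_turn u v) = v"
proof -
  have "formA (half_turn u v) u = formA v u"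
    using assms by (simp add: half_turn_def formA_diff_left formA_scaleC_left)
  then show ?thesis
    by (simp add: half_turn_def)
qed

lemma half_turn_isometry:
  assumes u: "formA u u \<noteq> 0"
  shows "half_turn u \<in> isometry_group"
proof -
  have "bounded_linear (half_turn u)"
    unfolding half_turn_def
    by (intro bounded_linear_sub bounded_linear_ident
        bounded_linear_compose[OF bounded_bilinear.bounded_linear_left[OF bounded_bilinear_scaleC]]
        bounded_linear_compose[OF bounded_linear_divide]
        bounded_linear_compose[OF bounded_linear_mult_right] bounded_linear_formA_left)
  moreover have "half_turn u (c *\<^sub>C v) = c *\<^sub>C half_turn u v" for c v
    by (simp add: half_turn_def formA_scaleC_left complex_vector.scale_right_diff_distrib
        scaleC_scaleC mult.left_commute)
  moreover have "bij (half_turn u)"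
    using u by (intro o_bij[of "half_turn u"]) (auto simp: half_turn_half_turn)
  moreover have "formA (half_turn u v) (half_turn u w) = formA v w" for v w
  proof -
    \<comment> \<open>Since \<open>formA u u\<close> is real, the two cross terms cancel the
      quadratic one.\<close>
    have "formA u w = cnj (formA w u)" "cnj (formA u u) = formA u u"
      by (rule formA_commute) (rule formA_commute[symmetric])
    then show ?thesis
      using u by (simp add: half_turn_def formA_diff_left formA_diff_right formA_scaleC_left
          formA_scaleC_right field_simps)
  qed
  ultimately show ?thesis
    by (simp add: isometry_group_def bounded_clinear_def)
qed

text \<open>The half-turn about the bisector of \<open>(0, 1)\<close> and \<open>(x, 1) / sqrt (1 - (norm x)\<^sup>2)\<close>.\<close>

definition boost :: "'a::chilbert_space \<Rightarrow> 'a \<times> complex \<Rightarrow> 'a \<times> complex" where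
  "boost x = half_turn (x, of_real (1 + sqrt (1 - (norm x)\<^sup>2)))"

text \<open>With \<open>s = sqrt (1 - (norm x)\<^sup>2)\<close>, the axis is the sum of
  \<open>(x, 1)\<close> and \<open>s\<close> times \<open>(0, 1)\<close>. Both have
  \<open>formQ\<close> equal to \<open>- s\<^sup>2\<close> and their mutual form value is real, so
  the half-turn about their sum exchanges them.\<close>

lemma
  assumes x: "norm x < 1"
  shows boost_isometry: "boost x \<in> isometry_group"
    and boost_boost: "boost x (boost x v) = v"
    and boost_eigen: "boost x (x, 1) = of_real (sqrt (1 - (norm x)\<^sup>2)) *\<^sub>C (0, 1)"
proof -
  define s where "s = sqrt (1 - (norm x)\<^sup>2)"
  have s: "s > 0" "s\<^sup>2 = 1 - (norm x)\<^sup>2"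
    using x by (simp_all add: s_def abs_square_less_1 abs_square_le_1)
  let ?u = "(x, complex_of_real (1 + s))"
  have "formQ ?u = - (2 * s * (1 + s))"
    unfolding formQ_eq norm_of_real using s by (simp add: power2_eq_square algebra_simps)
  then have A: "formA ?u ?u = of_real (- (2 * s * (1 + s)))"
    by (simp only: formA_self)
  have "formA ?u ?u \<noteq> 0"
    unfolding A using s(1) by (simp only: of_real_eq_0_iff) simp
  then show "boost x \<in> isometry_group" and *: "boost x (boost x v) = v" for v
    by (simp_all add: boost_def half_turn_isometry half_turn_half_turn flip: s_def)
  \<comment> \<open>The image of \<open>(0, 1)\<close> is computed because only second components
    enter here; the involution then turns it into the image of \<open>(x, 1)\<close>.\<close>
  have "formA (0, 1) ?u = of_real (- (1 + s))"
    by (simp add: formA_def cinner_zero_left)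
  then have "2 * formA (0, 1) ?u / formA ?u ?u = of_real (2 * (- (1 + s)) / (- (2 * s * (1 + s))))"
    unfolding A by (simp only: of_real_divide of_real_mult of_real_numeral)
  also have "2 * (- (1 + s)) / (- (2 * s * (1 + s))) = 1 / s"
    using s(1) by (simp add: divide_simps)
  finally have "boost x (0, 1) = of_real (1 / s) *\<^sub>C ?u - (0, 1)"
    by (simp add: boost_def half_turn_def flip: s_def)
  also have "\<dots> = of_real (1 / s) *\<^sub>C (x, 1)"
    using s(1) by (simp add: scaleC_prod_def scaleC_complex_def field_simps)
  finally have "of_real s *\<^sub>C boost x (0, 1) = (x, 1)"
    using s(1) by (simp add: scaleC_scaleC scaleC_one flip: of_real_mult)
  then show "boost x (x, 1) = of_real (sqrt (1 - (norm x)\<^sup>2)) *\<^sub>C (0, 1)"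
    using * isometry_groupD(2)[OF \<open>boost x \<in> isometry_group\<close>] by (metis s_def)
qed

lemma inv_boost: "norm x < 1 \<Longrightarrow> inv (boost x) = boost x"
  by (rule inv_equality) (simp_all add: boost_boost)

text \<open>The boost carries \<open>(x, 1)\<close> to a nonzero multiple of \<open>(0, 1)\<close>,
  and pairing with \<open>(0, 1)\<close> reads off minus the second component. Thus the complement
  of \<open>(x, 1)\<close> is the preimage of \<open>H \<times> {0}\<close>.\<close>

lemma formA_eigenvector_eq_0:
  assumes x: "norm x < 1"
  shows "formA v (x, 1) = 0 \<longleftrightarrow> snd (boost x v) = 0"
proof -
  have "formA v (x, 1) = formA (boost x v) (boost x (x, 1))"
    using isometry_groupD(5)[OF boost_isometry[OF x]] by simp
  also have "\<dots> = - of_real (sqrt (1 - (norm x)\<^sup>2)) * snd (boost x v)"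
    by (simp add: boost_eigen[OF x] formA_scaleC_right) (simp add: formA_def cinner_zero_right)
  moreover have "sqrt (1 - (norm x)\<^sup>2) \<noteq> 0"
    using x abs_square_less_1[of "norm x"] by simp
  ultimately show ?thesis
    by simp
qed

section \<open>A non-isotropic line and its complement\<close>

lemma dagger_cspan_singleton: "dagger (cspan {w}) = {v. formA v w = 0}"
proof -
  have "w \<in> cspan {w}"
    by (simp add: complex_vector.span_base)
  then show ?thesis
    by (auto simp: dagger_def complex_vector.span_singleton formA_scaleC_right)
qed

lemma csubspace_dagger: "csubspace (dagger M)"
  by (auto simp: complex_vector.subspace_def dagger_def formA_add_left formA_scaleC_left)
    (simp add: formA_def cinner_zero_left)

lemma closed_dagger: "closed (dagger M)"
proof -
  have "dagger M = (\<Inter>m\<in>M. {v. formA v m = 0})"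
    by (auto simp: dagger_def)
  moreover have "closed {v. formA v m = 0}" for m :: "'a \<times> complex"
    by (intro closed_Collect_eq continuous_on_const linear_continuous_on bounded_linear_formA_left)
  ultimately show ?thesis
    by auto
qed

text \<open>The line is the fixed point set of the continuous form-orthogonal projection onto
  it.\<close>

lemma closed_cspan_singleton:
  assumes w: "formA w w \<noteq> 0"
  shows "closed (cspan {w})"
proof -
  have "cspan {w} = {v. (formA v w / formA w w) *\<^sub>C w = v}"
  proof (intro set_eqI iffI)
    fix v assume "v \<in> cspan {w}"
    then show "v \<in> {v. (formA v w / formA w w) *\<^sub>C w = v}"
      using w by (auto simp: complex_vector.span_singleton formA_scaleC_left)
  next
    fix v assume "v \<in> {v. (formA v w / formA w w) *\<^sub>C w = v}"
    then have "v = (formA v w / formA w w) *\<^sub>C w"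
      by simp
    then show "v \<in> cspan {w}"
      unfolding complex_vector.span_singleton by (rule range_eqI)
  qed
  moreover have "closed {v. (formA v w / formA w w) *\<^sub>C w = v}"
    by (intro closed_Collect_eq continuous_on_id linear_continuous_on
        bounded_linear_compose[OF bounded_bilinear.bounded_linear_left[OF bounded_bilinear_scaleC]]
        bounded_linear_compose[OF bounded_linear_divide] bounded_linear_formA_left)
  ultimately show ?thesis
    by simp
qed

text \<open>The same projection splits every vector. A multiple \<open>k\<close> of \<open>w\<close>
  lying in the complement satisfies \<open>k * formA w w = 0\<close>, which forces
  \<open>k = 0\<close>.\<close>

lemma direct_sum_of_dagger:
  assumes w: "formA w w \<noteq> 0"
  shows "direct_sum_of (cspan {w}) (dagger (cspan {w}))"
  unfolding direct_sum_of_def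
proof (intro conjI allI closed_cspan_singleton w closed_dagger csubspace_dagger
    complex_vector.subspace_span)
  show "cspan {w} \<inter> dagger (cspan {w}) = {0}"
  proof (intro set_eqI iffI)
    fix v assume "v \<in> cspan {w} \<inter> dagger (cspan {w})"
    then obtain k where "v = k *\<^sub>C w" "formA v w = 0"
      by (auto simp: dagger_cspan_singleton) (auto simp: complex_vector.span_singleton)
    then show "v \<in> {0}"
      using w by (simp add: formA_scaleC_left)
  qed (use complex_vector.subspace_0[OF csubspace_dagger] complex_vector.span_zero in auto)
  fix v
  let ?m = "(formA v w / formA w w) *\<^sub>C w"
  have "?m \<in> cspan {w}" "v - ?m \<in> dagger (cspan {w})"
    using w by (simp_all add: complex_vector.span_scale complex_vector.span_base
        dagger_cspan_singleton formA_diff_left formA_scaleC_left)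
  then show "\<exists>m\<in>cspan {w}. \<exists>n\<in>dagger (cspan {w}). v = m + n"
    by (metis add.commute diff_add_cancel)
qed

lemma hilbert_on_dagger:
  assumes x: "norm x < 1"
  shows "hilbert_on (dagger (cspan {(x, 1)})) formA"
proof -
  let ?N = "dagger (cspan {(x, 1)})" and ?R = "boost x"
  note R = isometry_groupD[OF boost_isometry[OF x]]
  have N: "v \<in> ?N \<longleftrightarrow> snd (?R v) = 0" for v
    by (simp add: dagger_cspan_singleton formA_eigenvector_eq_0[OF x])
  have sqrtA: "sqrt (Re (formA v v)) = norm (?R v)" if "v \<in> ?N" for v
  proof -
    have "Re (formA v v) = formQ (fst (?R v), snd (?R v))"
      using R(5)[of v v] by (simp add: formQ_def)
    then show ?thesis
      using that by (subst (asm) formQ_eq) (simp add: N norm_prod_def)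
  qed
  have diff: "u - v \<in> ?N" if "u \<in> ?N" "v \<in> ?N" for u v
    using that csubspace_dagger complex_vector.subspace_diff by blast
  have "Re (formA v v) > 0" if "v \<in> ?N" "v \<noteq> 0" for v
  proof -
    have "?R v \<noteq> 0"
      using that R(1) boost_boost[OF x, of v] linear_0[OF bounded_linear.linear] by metis
    then show ?thesis
      using sqrtA[OF that(1)] by (metis real_sqrt_gt_0_iff zero_less_norm_iff)
  qed
  moreover have "\<exists>l\<in>?N. (\<lambda>n. sqrt (Re (formA (s n - l) (s n - l)))) \<longlonglongrightarrow> 0"
    if s: "range s \<subseteq> ?N"
      and C: "\<forall>e>0. \<exists>M. \<forall>m\<ge>M. \<forall>n\<ge>M. sqrt (Re (formA (s m - s n) (s m - s n))) < e" for s
  proof -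
    have sN: "s n \<in> ?N" for n
      using s by auto
    \<comment> \<open>The boost turns the form norm into the ambient norm, whose completeness
      provides the limit.\<close>
    have "norm (?R (s m) - ?R (s n)) = sqrt (Re (formA (s m - s n) (s m - s n)))" for m n
      by (simp only: sqrtA[OF diff[OF sN sN]] linear_diff[OF bounded_linear.linear[OF R(1)]])
    then have "Cauchy (\<lambda>n. ?R (s n))"
      using C by (simp add: Cauchy_def dist_norm)
    then obtain l where l: "(\<lambda>n. ?R (s n)) \<longlonglongrightarrow> l"
      using Cauchy_convergent_iff convergent_def by blast
    \<comment> \<open>The limit stays in the closed subspace \<open>H \<times> {0}\<close>, so the
      boost takes it back into the complement.\<close>
    have "(\<lambda>n. snd (?R (s n))) \<longlonglongrightarrow> snd l"
      using l by (rule tendsto_snd)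
    then have "snd l = 0"
      using sN by (simp add: N LIMSEQ_const_iff)
    then have lN: "?R l \<in> ?N"
      by (simp add: N boost_boost[OF x])
    have "sqrt (Re (formA (s n - ?R l) (s n - ?R l))) = norm (?R (s n) - l)" for n
      by (simp only: sqrtA[OF diff[OF sN lN]] linear_diff[OF bounded_linear.linear[OF R(1)]]
          boost_boost[OF x])
    then show ?thesis
      using lN l by (intro bexI[of _ "?R l"]) (simp_all add: tendsto_norm_zero_iff LIM_zero)
  qed
  ultimately show ?thesis
    unfolding hilbert_on_def
    by (simp add: csubspace_dagger formA_add_left formA_scaleC_left flip: formA_commute)
qed

section \<open>Isometries with a non-isotropic eigenvector\<close>

text \<open>Invariance gives \<open>c * cnj c * formA v v = formA v v\<close>, where the nonzero
  factor \<open>formA v v\<close> cancels.\<close>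

lemma isometry_eigenvalue:
  assumes T: "T \<in> isometry_group" and v: "formA v v \<noteq> 0" "T v = c *\<^sub>C v"
  shows "norm c = 1"
proof -
  have "(c * cnj c) * formA v v = formA (T v) (T v)"
    using v by (simp add: formA_scaleC_left formA_scaleC_right)
  then have "c * cnj c = 1"
    using v isometry_groupD(5)[OF T, of v v] by simp
  then have "(norm c)\<^sup>2 = 1"
    by (metis complex_norm_square of_real_eq_1_iff)
  then show ?thesis
    using norm_ge_zero[of c] by (auto simp: power2_eq_1_iff simp del: norm_ge_zero)
qed

text \<open>Replacing \<open>T w\<close> by \<open>c *\<^sub>C w\<close> in
  \<open>formA (T v) (T w) = formA v w\<close> leaves the factor \<open>cnj c\<close>, which is
  nonzero. One direction gives invariance of the complement, the other surjectivity of the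
  restriction.\<close>

lemma isometry_dagger_iff:
  assumes T: "T \<in> isometry_group" and w: "formA w w \<noteq> 0" "T w = c *\<^sub>C w"
  shows "T v \<in> dagger (cspan {w}) \<longleftrightarrow> v \<in> dagger (cspan {w})"
proof -
  have "formA v w = cnj c * formA (T v) w"
    using isometry_groupD(5)[OF T, of v w] w by (simp add: formA_scaleC_right)
  moreover have "c \<noteq> 0"
    using isometry_eigenvalue[OF T w] by auto
  ultimately show ?thesis
    by (simp add: dagger_cspan_singleton)
qed

lemma unitary_on_dagger:
  assumes T: "T \<in> isometry_group" and w: "formA w w \<noteq> 0" "T w = c *\<^sub>C w"
  shows "restrict T (dagger (cspan {w})) \<in> unitary_group (dagger (cspan {w})) formA"
proof -
  let ?N = "dagger (cspan {w})"
  note N = isometry_dagger_iff[OF T w]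
  have "bij_betw T ?N ?N"
    unfolding bij_betw_def
  proof
    show "inj_on T ?N"
      using isometry_groupD(4)[OF T] by (meson bij_is_inj inj_on_subset subset_UNIV)
    show "T ` ?N = ?N"
    proof (intro subset_antisym subsetI)
      fix v assume "v \<in> ?N"
      \<comment> \<open>The preimage is found in the whole space; the equivalence \<open>N\<close>
        then places it in the complement.\<close>
      moreover obtain u where "v = T u"
        using isometry_groupD(4)[OF T] by (meson bij_pointE)
      ultimately show "v \<in> T ` ?N"
        using N by simp
    qed (use N in auto)
  qed
  then show ?thesis
    using N isometry_groupD[OF T] csubspace_dagger[of "cspan {w}"]
    by (auto simp: unitary_group_def complex_vector.subspace_def cong: bij_betw_cong)
qed

lemma op_direct_sum_dagger:
  assumes T: "T \<in> isometry_group" and w: "formA w w \<noteq> 0" "T w = c *\<^sub>C w"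
  shows "op_direct_sum T (cspan {w}) (restrict T (cspan {w}))
    (dagger (cspan {w})) (restrict T (dagger (cspan {w})))"
proof -
  have "T v \<in> cspan {w}" if "v \<in> cspan {w}" for v
    using that w(2) by (auto simp: complex_vector.span_singleton isometry_groupD(2)[OF T]
        scaleC_scaleC)
  then show ?thesis
    using isometry_dagger_iff[OF T w] isometry_groupD(3)[OF T]
    by (auto simp: op_direct_sum_def simp del: split_paired_All)
qed

section \<open>Conjugation to a unitary operator\<close>

text \<open>The inner product is the form plus twice the product of one second component with the
  conjugate of the other. Pairing with \<open>(0, 1)\<close> shows that \<open>S\<close> multiplies
  second components by the unimodular \<open>c\<close>, so it preserves both summands.\<close>

lemma unitary_fixing_origin:
  assumes S: "S \<in> isometry_group" and c: "S (0, 1) = c *\<^sub>C (0, 1)"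
  shows "S \<in> unitary_group UNIV cinner"
proof -
  have e: "formA v (0, 1) = - snd v" for v :: "'a \<times> complex"
    by (simp add: formA_def cinner_zero_right)
  have n: "norm c = 1"
    using isometry_eigenvalue[OF S _ c] by (simp add: e)
  have snd: "snd v = cnj c * snd (S v)" for v
    using isometry_groupD(5)[OF S, of v "(0, 1)"] by (simp add: c formA_scaleC_right e)
  have A: "cinner u v = formA u v + 2 * snd u * cnj (snd v)" for u v :: "'a \<times> complex"
    by (simp add: formA_def cinner_prod_def cinner_complex_def)
  have "c * cnj c = 1"
    using n by (simp flip: complex_norm_square)
  then have "snd u * cnj (snd v) = snd (S u) * cnj (snd (S v))" for u v
    by (subst (1 2) snd) (simp add: algebra_simps)
  then have "cinner (S u) (S v) = cinner u v" for u v
    by (simp add: A isometry_groupD(5)[OF S] mult.assoc)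
  then show ?thesis
    using isometry_groupD(2-4)[OF S] by (auto simp: unitary_group_def simp del: split_paired_All)
qed

lemma isometry_comp:
  assumes "S \<in> isometry_group" "T \<in> isometry_group"
  shows "S \<circ> T \<in> isometry_group"
  using isometry_groupD[OF assms(1)] isometry_groupD[OF assms(2)]
  by (auto simp: isometry_group_def bounded_clinear_def bij_comp
      intro: bounded_linear_compose[unfolded o_def[symmetric]])

text \<open>The boost exchanges the lines of \<open>(x, 1)\<close> and \<open>(0, 1)\<close>, so the
  conjugate has \<open>(0, 1)\<close> as an eigenvector with the same eigenvalue
  \<open>c\<close>.\<close>

lemma boost_conjugate_unitary:
  assumes T: "T \<in> isometry_group" and x: "norm x < 1" and c: "T (x, 1) = c *\<^sub>C (x, 1)"
  shows "boost x \<circ> T \<circ> boost x \<in> unitary_group UNIV cinner"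
proof (rule unitary_fixing_origin)
  let ?s = "complex_of_real (sqrt (1 - (norm x)\<^sup>2))"
  note R = isometry_groupD[OF boost_isometry[OF x]]
  have s: "?s \<noteq> 0"
    using x abs_square_less_1[of "norm x"] by simp
  have "(0, 1) = inverse ?s *\<^sub>C boost x (x, 1)"
    using s by (simp add: boost_eigen[OF x] scaleC_scaleC scaleC_one)
  then have "boost x (0, 1) = inverse ?s *\<^sub>C (x, 1)"
    by (simp add: R(2) boost_boost[OF x])
  then show "(boost x \<circ> T \<circ> boost x) (0, 1) = c *\<^sub>C (0, 1)"
    using s by (simp add: isometry_groupD(2)[OF T] c R(2) boost_eigen[OF x] scaleC_scaleC
        scaleC_one mult.left_commute)
qed (intro isometry_comp boost_isometry x T)

section \<open>The spectrum\<close>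

lemma op_spectrum_unitary:
  fixes U :: "'a::chilbert_space \<Rightarrow> 'a"
  assumes U: "U \<in> unitary_group UNIV cinner"
  shows "op_spectrum U \<subseteq> sphere 0 1"
proof (rule subsetI, rule ccontr)
  fix c assume c: "c \<in> op_spectrum U" "c \<notin> sphere 0 1"
  define D where "D v = U v - c *\<^sub>C v" for v
  have U_add: "U (u + v) = U u + U v" and U_scale: "U (a *\<^sub>C u) = a *\<^sub>C U u"
    and U_bij: "bij U" and U_inner: "cinner (U u) (U v) = cinner u v" for u v a
    using U by (auto simp: unitary_group_def)
  have U_norm: "norm (U v) = norm v" for v
    by (simp add: norm_eq_sqrt_inner inner_eq_Re_cinner U_inner)
  have U_diff: "U (u - v) = U u - U v" for u v
    using U_add[of "u - v" v] by simp
  have D_add: "D (u + v) = D u + D v" and D_scale: "D (a *\<^sub>C u) = a *\<^sub>C D u" for u v a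
    by (simp_all add: D_def U_add U_scale scaleC_add_right scaleC_scaleC mult.commute
        complex_vector.scale_right_diff_distrib)
  \<comment> \<open>This bound, from the reverse triangle inequality, yields both the injectivity of
    \<open>D\<close> and the boundedness of its inverse.\<close>
  have D_norm: "\<bar>norm c - 1\<bar> * norm v \<le> norm (D v)" for v
  proof -
    have "\<bar>norm c - 1\<bar> * norm v = \<bar>(norm c - 1) * norm v\<bar>"
      by (simp add: abs_mult)
    then have "\<bar>norm c - 1\<bar> * norm v = \<bar>norm (c *\<^sub>C v) - norm (U v)\<bar>"
      by (simp add: norm_scaleC U_norm left_diff_distrib)
    then show ?thesis
      using norm_triangle_ineq3[of "U v" "c *\<^sub>C v"] by (simp add: D_def abs_minus_commute)
  qed
  have D_surj: "\<exists>v. D v = y" for y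
  proof (cases "norm c < 1")
    case True
    have inv: "U (inv U v) = v" for v
      using U_bij by (simp add: bij_is_surj surj_f_inv_f)
    \<comment> \<open>\<open>inv U\<close> preserves norms, so the contraction constant is
      \<open>norm c\<close>. No division by \<open>c\<close> occurs, so \<open>c = 0\<close> is
      covered.\<close>
    have "dist (inv U (y + c *\<^sub>C u)) (inv U (y + c *\<^sub>C v)) = norm c * dist u v" for u v
    proof -
      have "norm (inv U (y + c *\<^sub>C u) - inv U (y + c *\<^sub>C v))
          = norm (U (inv U (y + c *\<^sub>C u) - inv U (y + c *\<^sub>C v)))"
        by (simp only: U_norm)
      also have "\<dots> = norm (c *\<^sub>C (u - v))"
        by (simp add: U_diff inv complex_vector.scale_right_diff_distrib)
      finally show ?thesis
        by (simp add: dist_norm norm_scaleC)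
    qed
    then obtain v where "inv U (y + c *\<^sub>C v) = v"
      using banach_fix_type[of "norm c" "\<lambda>v. inv U (y + c *\<^sub>C v)"] True by auto
    then have "U v = y + c *\<^sub>C v"
      using inv by metis
    then show ?thesis
      by (intro exI[of _ v]) (simp add: D_def)
  next
    case False
    then have n: "norm c > 1"
      using c(2) by simp
    \<comment> \<open>Outside the circle, dividing by \<open>c\<close> contracts with constant
      \<open>inverse (norm c)\<close>.\<close>
    have "dist (inverse c *\<^sub>C (U u - y)) (inverse c *\<^sub>C (U v - y))
        = inverse (norm c) * dist u v" for u v
      by (simp add: dist_norm norm_scaleC norm_inverse U_norm
          flip: complex_vector.scale_right_diff_distrib U_diff)
    then obtain v where "inverse c *\<^sub>C (U v - y) = v"
      using banach_fix_type[of "inverse (norm c)" "\<lambda>v. inverse c *\<^sub>C (U v - y)"] n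
      by (auto simp: inverse_less_1_iff)
    then have "c *\<^sub>C v = (c * inverse c) *\<^sub>C (U v - y)"
      by (metis scaleC_scaleC)
    moreover have "c * inverse c = 1"
      using n by (intro right_inverse) auto
    ultimately have "c *\<^sub>C v = U v - y"
      by (simp only: scaleC_one)
    then show ?thesis
      by (intro exI[of _ v]) (simp add: D_def)
  qed
  have pos: "\<bar>norm c - 1\<bar> > 0"
    using c(2) by simp
  have "D u = D v \<Longrightarrow> u = v" for u v
    using D_norm[of "u - v"] D_add[of "u - v" v] pos by (simp add: mult_le_0_iff)
  then have SD: "inv D (D v) = v" for v
    by (simp add: injI)
  have DS: "D (inv D v) = v" for v
    using D_surj by (metis f_inv_into_f rangeI)
  have S_scale: "inv D (a *\<^sub>C u) = a *\<^sub>C inv D u" for a u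
    by (metis SD DS D_scale)
  have "bounded_linear (inv D)"
  proof (rule bounded_linear_intro[where K = "inverse \<bar>norm c - 1\<bar>"])
    show "inv D (u + v) = inv D u + inv D v" for u v
      by (metis SD DS D_add)
    show "inv D (r *\<^sub>R u) = r *\<^sub>R inv D u" for r u
      by (simp add: scaleR_scaleC S_scale)
    show "norm (inv D v) \<le> norm v * inverse \<bar>norm c - 1\<bar>" for v
      using D_norm[of "inv D v"] pos by (simp add: DS field_simps)
  qed
  then have "bounded_clinear (inv D)"
    by (simp add: bounded_clinear_def S_scale)
  then show False
    using c(1) SD DS unfolding op_spectrum_def D_def by blast
qed

text \<open>If \<open>S\<close> inverts \<open>R \<circ> T \<circ> R\<close> minus \<open>c\<close>,
  then \<open>R \<circ> S \<circ> R\<close> inverts \<open>T\<close> minus \<open>c\<close>, because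
  \<open>R\<close> is its own inverse.\<close>

lemma op_spectrum_conjugate:
  assumes R: "bounded_clinear R" "\<And>v. R (R v) = v"
  shows "op_spectrum T \<subseteq> op_spectrum (R \<circ> T \<circ> R)"
proof (rule subsetI, rule ccontr)
  have lin: "bounded_linear R" and R_scale: "R (a *\<^sub>C v) = a *\<^sub>C R v" for a v
    using R(1) by (simp_all add: bounded_clinear_def)
  note R_diff = linear_diff[OF bounded_linear.linear[OF lin]]
  fix c assume c: "c \<in> op_spectrum T" "c \<notin> op_spectrum (R \<circ> T \<circ> R)"
  then obtain S where S: "bounded_clinear S"
    and l: "S (R (T (R v)) - c *\<^sub>C v) = v" and r: "R (T (R (S v))) - c *\<^sub>C S v = v" for v
    by (auto simp: op_spectrum_def)
  have "bounded_clinear (R \<circ> S \<circ> R)"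
    using R(1) S unfolding bounded_clinear_def o_def
    by (auto intro!: bounded_linear_compose[of R] bounded_linear_compose[of S])
  moreover have "(R \<circ> S \<circ> R) (T v - c *\<^sub>C v) = v" for v
    using l[of "R v"] by (simp add: R_diff R_scale R(2))
  moreover have "T ((R \<circ> S \<circ> R) v) - c *\<^sub>C (R \<circ> S \<circ> R) v = v" for v
    using arg_cong[OF r[of "R v"], of R] by (simp add: R_diff R_scale R(2))
  ultimately show False
    using c(1) unfolding op_spectrum_def by blast
qed

section \<open>Fixed points in the ball and time-like eigenvectors\<close>

text \<open>If \<open>T (x, 1) = (y, w)\<close>, then \<open>x\<close> is fixed exactly when
  \<open>y = w *\<^sub>C x\<close>, that is, when \<open>(x, 1)\<close> is an eigenvector with
  eigenvalue \<open>w\<close>.\<close>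

lemma elliptic_iff_eigenvector:
  assumes T: "T \<in> isometry_group"
  shows "elliptic T \<longleftrightarrow> (\<exists>x. norm x < 1 \<and> (\<exists>c. T (x, 1) = c *\<^sub>C (x, 1)))"
proof -
  have "ball_action T x = x \<longleftrightarrow> (\<exists>c. T (x, 1) = c *\<^sub>C (x, 1))" if x: "norm x < 1" for x
  proof -
    obtain y w where yw: "T (x, 1) = (y, w)"
      by (cases "T (x, 1)")
    have w: "w \<noteq> 0"
      using ball_action_denominator_nonzero[OF T, of x] x yw by simp
    have "inverse w *\<^sub>C y = x \<longleftrightarrow> y = w *\<^sub>C x"
      using w by (auto simp: scaleC_scaleC scaleC_one)
    then show ?thesis
      by (auto simp: ball_action_def yw scaleC_prod_def scaleC_complex_def)
  qed
  then show ?thesis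
    by (auto simp: elliptic_def)
qed

text \<open>A time-like \<open>(y, w)\<close> has \<open>norm y < norm w\<close>, hence
  \<open>w \<noteq> 0\<close>; dividing by \<open>w\<close> gives a vector of the form
  \<open>(x, 1)\<close> on the same eigenline with \<open>x\<close> in the open ball.\<close>

lemma time_like_eigenvector_iff:
  assumes T: "T \<in> isometry_group"
  shows "(\<exists>v. time_like v \<and> eigenvector T v) \<longleftrightarrow> elliptic T"
proof
  assume "\<exists>v. time_like v \<and> eigenvector T v"
  then obtain y w c where yw: "norm y < norm w" and c: "T (y, w) = c *\<^sub>C (y, w)"
    by (auto simp: eigenvector_def time_like_iff)
  have w: "w \<noteq> 0"
    using yw by auto
  have "norm (inverse w *\<^sub>C y) < 1"
    using yw w by (simp add: norm_scaleC norm_inverse norm_divide divide_simps)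
  moreover have "(inverse w *\<^sub>C y, 1) = inverse w *\<^sub>C (y, w)"
    using w by (simp add: scaleC_prod_def scaleC_complex_def)
  then have "T (inverse w *\<^sub>C y, 1) = c *\<^sub>C (inverse w *\<^sub>C y, 1)"
    by (simp only: isometry_groupD(2)[OF T] c scaleC_scaleC mult.commute)
  ultimately show "elliptic T"
    using elliptic_iff_eigenvector[OF T] by blast
next
  assume "elliptic T"
  then obtain x c where "norm x < 1" "T (x, 1) = c *\<^sub>C (x, 1)"
    using elliptic_iff_eigenvector[OF T] by blast
  then have "time_like (x, 1) \<and> eigenvector T (x, 1)"
    by (auto simp: time_like_iff eigenvector_def zero_prod_def)
  then show "\<exists>v. time_like v \<and> eigenvector T v"
    by blast
qed

theorem theorem1p2:
  fixes T :: "'a::chilbert_space \<times> complex \<Rightarrow> 'a \<times> complex"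
  assumes "T \<in> isometry_group" and "elliptic T"
  shows "(\<exists>R\<in>isometry_group. inv R \<circ> T \<circ> R \<in> unitary_group UNIV cinner)
    \<and> op_spectrum T \<subseteq> sphere 0 1
    \<and> (\<exists>v. time_like v \<and> eigenvector T v)
    \<and> (\<forall>S :: 'a \<times> complex \<Rightarrow> 'a \<times> complex.
         S \<in> isometry_group \<longrightarrow> (\<exists>v. time_like v \<and> eigenvector S v) \<longrightarrow> elliptic S)
    \<and> (\<forall>x. time_like (x, 1) \<and> eigenvector T (x, 1) \<longrightarrow>
         (let L = cspan {(x, 1)}; N = dagger L in
            direct_sum_of L N
          \<and> op_direct_sum T L (restrict T L) N (restrict T N)
          \<and> hilbert_on N formA
          \<and> restrict T N \<in> unitary_group N formA))"
proof -
  note T = assms(1)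
  obtain x0 c0 where x0: "norm x0 < 1" "T (x0, 1) = c0 *\<^sub>C (x0, 1)"
    using assms elliptic_iff_eigenvector by blast
  note R = boost_isometry[OF x0(1)]
  have U: "boost x0 \<circ> T \<circ> boost x0 \<in> unitary_group UNIV cinner"
    by (rule boost_conjugate_unitary[OF T x0])
  have "\<exists>R\<in>isometry_group. inv R \<circ> T \<circ> R \<in> unitary_group UNIV cinner"
    using R U by (intro bexI[of _ "boost x0"]) (simp_all add: inv_boost x0(1))
  moreover have "op_spectrum T \<subseteq> sphere 0 1"
    using op_spectrum_conjugate[of "boost x0" T] op_spectrum_unitary[OF U] R boost_boost[OF x0(1)]
    by (auto simp: isometry_group_def)
  moreover have "let L = cspan {(x, 1)}; N = dagger L in
            direct_sum_of L N
          \<and> op_direct_sum T L (restrict T L) N (restrict T N)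
          \<and> hilbert_on N formA
          \<and> restrict T N \<in> unitary_group N formA"
    if x: "time_like (x, 1) \<and> eigenvector T (x, 1)" for x
  proof -
    obtain c where c: "T (x, 1) = c *\<^sub>C (x, 1)"
      using x by (auto simp: eigenvector_def)
    \<comment> \<open>Here \<open>x\<close> is arbitrary and may differ from \<open>x0\<close>.
      Being time-like makes \<open>(x, 1)\<close> non-isotropic and also gives
      \<open>norm x < 1\<close>, needed for completeness of the complement.\<close>
    have A: "formA (x, 1) (x, 1) \<noteq> 0"
      using x by (simp add: time_like_def formA_self)
    show ?thesis
      using x unfolding Let_def
      by (intro conjI direct_sum_of_dagger op_direct_sum_dagger[OF T A c] hilbert_on_dagger
          unitary_on_dagger[OF T A c] A) (simp add: time_like_iff)
  qed
  ultimately show ?thesis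
    using time_like_eigenvector_iff T assms(2) by blast
qed

end
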